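(* Let $\mathcal{H}$ be a real Hilbert space and let $(\mathcal{G}_k)_{k\in K}$ be a finite family of real Hilbert spaces. Let $A\colon\mathcal{H}\to 2^{\mathcal{H}}$ be monotone and, for every $k\in K$, let $B_k\colon\mathcal{G}_k\to 2^{\mathcal{G}_k}$ be $3^*$-monotone and let $L_k\colon\mathcal{H}\to 2^{\mathcal{G}_k}$ be linear (i.e., a linear relation). Set $$D=\bigcap_{k\in K}L_k^{-1}(\operatorname{dom} B_k).$$ Suppose that $A+\sum_{k\in K}L_k^*\circ B_k\circ L_k$ is maximally monotone. Then $D\neq\varnothing$ and $$\operatorname{ran}\Bigl(A+\sum_{k\in K}L_k^*\circ B_k\circ L_k\Bigr)\simeq A(D)+\sum_{k\in K}L_k^*(\operatorname{ran} B_k).$$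
   Context: Scalar products are denoted $\langle\cdot\mid\cdot\rangle$. For a set-valued operator $M\colon\mathcal{X}\to 2^{\mathcal{Y}}$ between real Hilbert spaces: the graph is $\operatorname{gra}M=\{(x,u)\in\mathcal{X}\times\mathcal{Y}\mid u\in Mx\}$, the domain is $\operatorname{dom}M=\{x\in\mathcal{X}\mid Mx\neq\varnothing\}$, the image of a set $S\subset\mathcal{X}$ is $M(S)=\bigcup_{x\in S}Mx$, the range is $\operatorname{ran}M=M(\mathcal{X})$, and the inverse $M^{-1}\colon\mathcal{Y}\to 2^{\mathcal{X}}$ is defined by $x\in M^{-1}u\Leftrightarrow u\in Mx$ (so $M^{-1}(S)=\{x\in\mathcal{X}\mid Mx\cap S\neq\varnothing\}$). Sums of operators are pointwise Minkowski sums, $(M+N)x=Mx+Nx=\{u+v\mid u\in Mx,\ v\in Nx\}$ (empty if either set is empty); compositions are $(N\circ M)x=N(Mx)=\bigcup_{u\in Mx}Nu$. Sums of sets are Minkowski sums. An operator $M\colon\mathcal{X}\to 2^{\mathcal{X}}$ is monotone if $\langle x-y\mid u-v\rangle\geq 0$ for all $(x,u),(y,v)\in\operatorname{gra}M$. It is maximally monotone if it is monotone and there is no monotone operator whose graph properly contains $\operatorname{gra}M$. A monotone operator $M$ is $3^*$-monotone if for all $x\in\operatorname{dom}M$ and all $u\in\operatorname{ran}M$, $\inf_{(y,v)\in\operatorname{gra}M}\langle x-y\mid u-v\rangle>-\infty$. A set-valued operator $L\colon\mathcal{H}\to 2^{\mathcal{G}}$ is linear if $\operatorname{gra}L$ is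 a vector subspace of $\mathcal{H}\times\mathcal{G}$. Its adjoint is the linear operator $L^*\colon\mathcal{G}\to 2^{\mathcal{H}}$ with graph $\operatorname{gra}L^*=\{(v,u)\in\mathcal{G}\times\mathcal{H}\mid \langle x\mid u\rangle=\langle y\mid v\rangle\ \text{for all}\ (x,y)\in\operatorname{gra}L\}$. For a subset $C$ of $\mathcal{H}$, $\overline{C}$ is its closure, and $\operatorname{rint}C$ is the interior of $C$ relative to the closed affine hull of $C$ (the smallest closed affine subspace of $\mathcal{H}$ containing $C$). For subsets $C,D$ of $\mathcal{H}$, $C\simeq D$ means that $\overline{C}=\overline{D}$ and $\operatorname{rint}C=\operatorname{rint}D$. *)

theory Defs
  imports "HOL-Analysis.Analysis" "HOL-Library.Set_Algebras" "HOL-Library.Function_Algebras"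
begin

text \<open>
  A set-valued operator from a set \<open>X\<close> to a set \<open>Y\<close> is a function \<open>M :: 'a \<Rightarrow> 'b set\<close> that takes
  nonempty values only on \<open>X\<close> and whose values are subsets of \<open>Y\<close>. Sums of sets are Minkowski
  sums (\<open>Set_Algebras\<close>), sums of operators are pointwise (\<open>Function_Algebras\<close>); in particular
  the empty sum of sets is \<open>{0}\<close> and the empty sum of operators is the constant \<open>{0}\<close>.
\<close>

definition gra :: "('a \<Rightarrow> 'b set) \<Rightarrow> ('a \<times> 'b) set" where
  "gra M = {(x, u). u \<in> M x}"

definition operator_between :: "'a set \<Rightarrow> 'b set \<Rightarrow> ('a \<Rightarrow> 'b set) \<Rightarrow> bool" where
  "operator_between X Y M \<longleftrightarrow> gra M \<subseteq> X \<times> Y"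

definition op_dom :: "('a \<Rightarrow> 'b set) \<Rightarrow> 'a set" where
  "op_dom M = {x. M x \<noteq> {}}"

definition op_image :: "('a \<Rightarrow> 'b set) \<Rightarrow> 'a set \<Rightarrow> 'b set" where
  "op_image M S = (\<Union>x\<in>S. M x)"

definition op_ran :: "('a \<Rightarrow> 'b set) \<Rightarrow> 'b set" where
  "op_ran M = op_image M UNIV"

definition op_inv :: "('a \<Rightarrow> 'b set) \<Rightarrow> 'b \<Rightarrow> 'a set" where
  "op_inv M u = {x. u \<in> M x}"

definition op_comp :: "('b \<Rightarrow> 'c set) \<Rightarrow> ('a \<Rightarrow> 'b set) \<Rightarrow> 'a \<Rightarrow> 'c set"  (infixl "\<circ>\<^sub>o" 75) where
  "(N \<circ>\<^sub>o M) x = op_image N (M x)"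

definition monotone_op :: "('a::real_inner \<Rightarrow> 'a set) \<Rightarrow> bool" where
  "monotone_op M \<longleftrightarrow> (\<forall>(x, u)\<in>gra M. \<forall>(y, v)\<in>gra M. (x - y) \<bullet> (u - v) \<ge> 0)"

definition maximally_monotone :: "('a::real_inner \<Rightarrow> 'a set) \<Rightarrow> bool" where
  "maximally_monotone M \<longleftrightarrow> monotone_op M \<and> \<not> (\<exists>N. monotone_op N \<and> gra M \<subset> gra N)"

definition three_star_monotone :: "('a::real_inner \<Rightarrow> 'a set) \<Rightarrow> bool" where
  "three_star_monotone M \<longleftrightarrow> monotone_op M \<and>
     (\<forall>x\<in>op_dom M. \<forall>u\<in>op_ran M. (INF (y, v)\<in>gra M. ereal ((x - y) \<bullet> (u - v))) > -\<infinity>)"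

definition linear_rel :: "('a::real_vector \<Rightarrow> 'b::real_vector set) \<Rightarrow> bool" where
  "linear_rel L \<longleftrightarrow> subspace (gra L)"

text \<open>
  Adjoint of a linear relation from the whole space \<open>'a\<close> to the subspace \<open>G\<close> of \<open>'b\<close>. It depends
  on \<open>G\<close>: without the restriction \<open>v \<in> G\<close>, the orthogonal complement of \<open>G\<close> would be added to
  its domain.
\<close>

definition adjoint_rel ::
    "'b::real_inner set \<Rightarrow> ('a::real_inner \<Rightarrow> 'b set) \<Rightarrow> 'b \<Rightarrow> 'a set" where
  "adjoint_rel G L v = {u. v \<in> G \<and> (\<forall>(x, y)\<in>gra L. x \<bullet> u = y \<bullet> v)}"

definition closed_affine_hull :: "'a::real_normed_vector set \<Rightarrow> 'a set" where
  "closed_affine_hull C = (\<lambda>S. affine S \<and> closed S) hull C"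

text \<open>
  This differs from the library's \<open>rel_interior\<close>, which is relative to the affine hull; the affine
  hull need not be closed in infinite dimension.
\<close>

definition rint :: "'a::real_normed_vector set \<Rightarrow> 'a set" where
  "rint C = top_of_set (closed_affine_hull C) interior_of C"

definition nearly_equal :: "'a::real_normed_vector set \<Rightarrow> 'a set \<Rightarrow> bool"  (infix "\<simeq>\<^sub>n" 50) where
  "C \<simeq>\<^sub>n D \<longleftrightarrow> closure C = closure D \<and> rint C = rint D"

end

theory Submission imports Defs begin

text \<open>
  Write \<open>M\<close> for the operator \<open>A + (\<Sum>k\<in>K. L\<^sub>k\<^sup>* \<circ> B\<^sub>k \<circ> L\<^sub>k)\<close> and \<open>C\<close> for the sum of images
  that is compared with its range. Call a point \<open>u\<close> \<^emph>\<open>tame\<close> for \<open>M\<close> if, for some \<open>x\<close>, the quantity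
  \<open>(x - y) \<bullet> (u - v)\<close> is bounded below as \<open>(y, v)\<close> runs through the graph of \<open>M\<close>; equivalently,
  \<open>u\<close> is the second component of a point where the Fitzpatrick function of \<open>M\<close> is not \<open>+\<infinity>\<close>. The
  near equality follows from the inclusions \<open>op_ran M \<subseteq> C \<subseteq> tame_points M\<close> and a range theorem in
  the style of Brezis and Haraux: for a maximally monotone operator, every set between the range
  and the set of tame points is nearly equal to the range.

  The domain of \<open>M\<close> is contained in \<open>D\<close>. This gives the first inclusion, and it makes \<open>D\<close>
  nonempty, because the graph of a maximally monotone operator cannot be empty.

  The points of \<open>C\<close> are tame because the defining identity of the adjoint moves the scalar
  product to the spaces \<open>G k\<close>. If \<open>x \<in> D\<close>, choose \<open>\<eta>\<^sub>k \<in> L\<^sub>k x\<close> in the domain of \<open>B\<^sub>k\<close>. The \<open>k\<close>-th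
  contribution to \<open>(x - y) \<bullet> (u - v)\<close> is then \<open>(\<eta>\<^sub>k - t) \<bullet> (w\<^sub>k - s)\<close>, with \<open>s \<in> B\<^sub>k t\<close> and with
  \<open>\<eta>\<^sub>k\<close> in the domain and \<open>w\<^sub>k\<close> in the range of \<open>B\<^sub>k\<close>. This is exactly what \<open>3\<^sup>*\<close>-monotonicity bounds
  below, while the contribution of \<open>A\<close> is nonnegative.

  The range theorem rests on the regularised inclusions \<open>u - \<epsilon> x\<^sub>\<epsilon> \<in> M x\<^sub>\<epsilon>\<close>, which are solvable
  by Minty's theorem. If \<open>u\<close> is tame, then \<open>\<epsilon> x\<^sub>\<epsilon> \<rightarrow> 0\<close>, so \<open>u\<close> lies in the closure of the range.
  If all points near \<open>u\<close> in the closed affine hull are tame, then \<open>x\<^sub>\<epsilon>\<close> is bounded above against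
  every direction of that hull, hence bounded in norm by the uniform boundedness principle. A
  bounded family \<open>x\<^sub>\<epsilon>\<close> converges strongly, because \<open>\<bar>x\<^sub>\<delta> - x\<^sub>\<epsilon>\<bar>\<^sup>2 \<le> \<bar>x\<^sub>\<delta>\<bar>\<^sup>2 - \<bar>x\<^sub>\<epsilon>\<bar>\<^sup>2\<close> for \<open>\<delta> \<le> \<epsilon>\<close>, and
  its limit \<open>x\<close> satisfies \<open>u \<in> M x\<close>.

  Minty's theorem is obtained by minimising the sum of the Fitzpatrick function and
  \<open>\<bar>(x, u)\<bar>\<^sup>2 / 2\<close>. This sum is strongly convex, so that minimising sequences are Cauchy, and the
  optimality condition at the minimiser says that a certain point is monotonically related to
  the whole graph.
\<close>

section \<open>Minimising a strongly convex function\<close>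

text \<open>
  The set \<open>E\<close> plays the role of the epigraph of a convex lower semicontinuous function \<open>f\<close>, to
  which \<open>\<bar>p\<bar>\<^sup>2 / 2\<close> is added; working with \<open>E\<close> avoids infinite values of \<open>f\<close>. The parallelogram
  identity makes every minimising sequence Cauchy. The conclusion is the optimality condition:
  \<open>-p\<close> is a subgradient of \<open>f\<close> at \<open>p\<close>.
\<close>

lemma strongly_convex_minimiser:
  fixes E :: "('a::{real_inner, complete_space} \<times> real) set"
  assumes "closed E" and conv: "convex E" and "E \<noteq> {}"
    and lower: "\<And>p r. (p, r) \<in> E \<Longrightarrow> 0 \<le> r + (norm p)\<^sup>2 / 2"
  obtains p r where "(p, r) \<in> E" "\<And>q t. (q, t) \<in> E \<Longrightarrow> r + p \<bullet> p \<le> t + p \<bullet> q"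
proof -
  define \<phi> :: "'a \<times> real \<Rightarrow> real" where "\<phi> z = snd z + (norm (fst z))\<^sup>2 / 2" for z
  define s where "s = Inf (\<phi> ` E)"
  have bdd: "bdd_below (\<phi> ` E)"
    by (rule bdd_belowI[of _ 0]) (use lower in \<open>auto simp: \<phi>_def\<close>)
  have s_le: "s \<le> \<phi> z" if "z \<in> E" for z
    unfolding s_def using bdd that by (intro cInf_lower) auto
  have "\<exists>z\<in>E. \<phi> z < s + inverse (real (Suc n))" for n
  proof -
    have "Inf (\<phi> ` E) < s + inverse (real (Suc n))"
      unfolding s_def by simp
    then show ?thesis
      using cInf_less_iff[OF _ bdd] \<open>E \<noteq> {}\<close> by auto
  qed
  then obtain z where zE: "\<And>n. z n \<in> E" and z_less: "\<And>n. \<phi> (z n) < s + inverse (real (Suc n))"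
    by metis
  have gap: "(norm (fst a - fst b))\<^sup>2 \<le> 4 * (\<phi> a + \<phi> b - 2 * s)" if "a \<in> E" "b \<in> E" for a b
  proof -
    let ?m = "(1/2) *\<^sub>R a + (1/2) *\<^sub>R b"
    have "?m \<in> E"
      using conv that by (intro convexD) auto
    then have "s \<le> \<phi> ?m" by (rule s_le)
    also have "\<phi> ?m = (\<phi> a + \<phi> b) / 2 - (norm (fst a - fst b))\<^sup>2 / 8"
      unfolding \<phi>_def power2_norm_eq_inner
      by (simp add: inner_add_left inner_add_right inner_diff_left inner_diff_right
          inner_commute field_simps)
    finally show ?thesis by (simp add: field_simps)
  qed
  have "Cauchy (\<lambda>n. fst (z n))"
  proof (rule metric_CauchyI)
    fix e :: real assume "e > 0"
    then obtain N where N: "inverse (real (Suc N)) < e\<^sup>2 / 8"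
      using reals_Archimedean[of "e\<^sup>2 / 8"] by auto
    have "dist (fst (z m)) (fst (z n)) < e" if "m \<ge> N" "n \<ge> N" for m n
    proof -
      have "inverse (real (Suc m)) \<le> inverse (real (Suc N))"
        "inverse (real (Suc n)) \<le> inverse (real (Suc N))"
        using that by (auto intro!: le_imp_inverse_le)
      with gap[OF zE zE, of m n] z_less[of m] z_less[of n] N
      have "(norm (fst (z m) - fst (z n)))\<^sup>2 < e\<^sup>2" by argo
      then show ?thesis
        using \<open>e > 0\<close> by (simp add: dist_norm power2_less_imp_less)
    qed
    then show "\<exists>N. \<forall>m\<ge>N. \<forall>n\<ge>N. dist (fst (z m)) (fst (z n)) < e" by blast
  qed
  then obtain p where p: "(\<lambda>n. fst (z n)) \<longlonglongrightarrow> p"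
    using Cauchy_convergent_iff convergent_def by blast
  have "(\<lambda>n. \<phi> (z n)) \<longlonglongrightarrow> s"
  proof (rule real_tendsto_sandwich)
    show "\<forall>\<^sub>F n in sequentially. s \<le> \<phi> (z n)" using s_le zE by simp
    show "\<forall>\<^sub>F n in sequentially. \<phi> (z n) \<le> s + inverse (real (Suc n))"
      using z_less by (simp add: less_imp_le)
    show "(\<lambda>n. s + inverse (real (Suc n))) \<longlonglongrightarrow> s"
      by (rule LIMSEQ_inverse_real_of_nat_add)
  qed simp
  then have "(\<lambda>n. \<phi> (z n) - (norm (fst (z n)))\<^sup>2 / 2) \<longlonglongrightarrow> s - (norm p)\<^sup>2 / 2"
    by (intro tendsto_intros p) auto
  then have "(\<lambda>n. snd (z n)) \<longlonglongrightarrow> s - (norm p)\<^sup>2 / 2"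
    by (simp add: \<phi>_def)
  from tendsto_Pair[OF p this] have "z \<longlonglongrightarrow> (p, s - (norm p)\<^sup>2 / 2)"
    by simp
  with zE \<open>closed E\<close> have pE: "(p, s - (norm p)\<^sup>2 / 2) \<in> E"
    using closed_sequentially by blast
  define r where "r = s - (norm p)\<^sup>2 / 2"
  have "r + p \<bullet> p \<le> t + p \<bullet> q" if qE: "(q, t) \<in> E" for q t
  proof (rule ccontr)
    define c where "c = t - r + p \<bullet> (q - p)"
    define d where "d = (norm (q - p))\<^sup>2"
    assume "\<not> ?thesis"
    then have c: "c < 0" by (simp add: c_def inner_diff_right)
    have d: "d \<ge> 0" by (simp add: d_def)
    \<comment> \<open>This step length makes the first-order decrease \<open>l * c\<close> dominate the quadratic
      term \<open>l\<^sup>2 * d / 2\<close>.\<close>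
    define l where "l = - c / (d - c)"
    have l: "0 < l" "l \<le> 1" using c d by (auto simp: l_def field_simps)
    have "(1 - l) *\<^sub>R (p, r) + l *\<^sub>R (q, t) \<in> E"
      using conv pE qE l by (intro convexD) (auto simp: r_def)
    then have "s \<le> \<phi> ((1 - l) *\<^sub>R (p, r) + l *\<^sub>R (q, t))" by (rule s_le)
    also have "\<dots> = s + l * (c + l * d / 2)"
      unfolding \<phi>_def c_def d_def r_def power2_norm_eq_inner
      by (simp add: inner_add_left inner_add_right inner_diff_left inner_diff_right
          inner_commute field_simps power2_eq_square)
    finally have "0 \<le> c + l * d / 2" using l by (simp add: zero_le_mult_iff)
    moreover have "l * d \<le> - c"
      using c d by (auto simp: l_def field_simps)
    ultimately show False using c by linarith
  qed
  with pE show thesis using that r_def by blast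
qed

section \<open>Minty's theorem\<close>

lemma monotone_opD:
  "monotone_op M \<Longrightarrow> u \<in> M x \<Longrightarrow> v \<in> M y \<Longrightarrow> 0 \<le> (x - y) \<bullet> (u - v)"
  by (auto simp: monotone_op_def gra_def)

text \<open>
  Maximality in pointwise form: adding a single point that is monotonically related to the graph
  preserves monotonicity.
\<close>

lemma maximally_monotone_iff:
  "maximally_monotone M \<longleftrightarrow> monotone_op M \<and>
    (\<forall>x u. (\<forall>y v. v \<in> M y \<longrightarrow> 0 \<le> (x - y) \<bullet> (u - v)) \<longrightarrow> u \<in> M x)"
proof (intro iffI conjI allI impI)
  assume M: "maximally_monotone M"
  then show mono: "monotone_op M" by (simp add: maximally_monotone_def)
  fix x u assume rel: "\<forall>y v. v \<in> M y \<longrightarrow> 0 \<le> (x - y) \<bullet> (u - v)"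
  show "u \<in> M x"
  proof (rule ccontr)
    assume "u \<notin> M x"
    define N where "N = M(x := insert u (M x))"
    have graN: "gra N = insert (x, u) (gra M)"
      by (auto simp: gra_def N_def split: if_splits)
    have "0 \<le> (y - x) \<bullet> (v - u)" if "v \<in> M y" for y v
    proof -
      have "(y - x) \<bullet> (v - u) = (x - y) \<bullet> (u - v)"
        by (simp add: inner_diff_left inner_diff_right)
      then show ?thesis using rel that by simp
    qed
    then have "monotone_op N"
      using rel mono unfolding monotone_op_def graN by (auto simp: gra_def)
    moreover have "gra M \<subset> gra N"
      using graN \<open>u \<notin> M x\<close> by (auto simp: gra_def)
    ultimately show False using M by (auto simp: maximally_monotone_def)
  qed
next
  assume M: "monotone_op M \<and>
    (\<forall>x u. (\<forall>y v. v \<in> M y \<longrightarrow> 0 \<le> (x - y) \<bullet> (u - v)) \<longrightarrow> u \<in> M x)"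
  have "gra N \<subseteq> gra M" if "monotone_op N" "gra M \<subseteq> gra N" for N
  proof
    fix p assume "p \<in> gra N"
    then obtain x u where p: "p = (x, u)" "u \<in> N x" by (auto simp: gra_def)
    have "\<forall>y v. v \<in> M y \<longrightarrow> 0 \<le> (x - y) \<bullet> (u - v)"
      using that p monotone_opD[of N u x] by (auto simp: gra_def)
    with M p show "p \<in> gra M" by (auto simp: gra_def)
  qed
  with M show "maximally_monotone M" by (auto simp: maximally_monotone_def)
qed

lemma maximally_monotoneD:
  assumes "maximally_monotone M" "\<And>y v. v \<in> M y \<Longrightarrow> 0 \<le> (x - y) \<bullet> (u - v)"
  shows "u \<in> M x"
  using assms by (auto simp: maximally_monotone_iff)

lemma maximally_monotone_nonempty:
  assumes "maximally_monotone M"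
  obtains x u where "u \<in> M x"
  using maximally_monotoneD[OF assms] by blast

text \<open>
  The set \<open>E\<close> in the proof is the epigraph of the Fitzpatrick function
  \<open>F (x, u) = (SUP (y, v) \<in> gra M. x \<bullet> v + y \<bullet> u - y \<bullet> v)\<close>. Maximality gives \<open>F (x, u) \<ge> x \<bullet> u\<close>,
  and \<open>F\<close> equals \<open>y \<bullet> v\<close> at the points of the graph. The optimality condition at a minimiser
  \<open>(a, b)\<close> of \<open>F + \<bar>\<cdot>\<bar>\<^sup>2 / 2\<close>, tested at the points of the graph, says that
  \<open>(y + b) \<bullet> (v + a) \<ge> \<bar>a + b\<bar>\<^sup>2\<close> for all of them. Hence \<open>(-b, -a)\<close> belongs to the graph, and
  testing at this point gives \<open>a = -b\<close>.
\<close>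

lemma minty_at_zero:
  fixes M :: "'h::{real_inner, complete_space} \<Rightarrow> 'h set"
  assumes M: "maximally_monotone M"
  obtains x where "- x \<in> M x"
proof -
  have mono: "monotone_op M" using M by (simp add: maximally_monotone_def)
  define E :: "(('h \<times> 'h) \<times> real) set" where
    "E = (\<Inter>(y, v)\<in>gra M. {z. fst (fst z) \<bullet> v + y \<bullet> snd (fst z) - y \<bullet> v \<le> snd z})"
  have E_iff: "((x, u), r) \<in> E \<longleftrightarrow> (\<forall>y v. v \<in> M y \<longrightarrow> x \<bullet> v + y \<bullet> u - y \<bullet> v \<le> r)" for x u r
    by (auto simp: E_def gra_def)
  have "closed E"
    unfolding E_def by (auto intro!: closed_INT closed_Collect_le continuous_intros)
  moreover have "convex E"
  proof -
    have "convex {z :: ('h \<times> 'h) \<times> real. fst (fst z) \<bullet> v + y \<bullet> snd (fst z) - y \<bullet> v \<le> snd z}"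
      (is "convex ?S") for y v
    proof (rule convexI)
      fix z w :: "('h \<times> 'h) \<times> real" and s t :: real
      assume zw: "z \<in> ?S" "w \<in> ?S" and st: "0 \<le> s" "0 \<le> t" "s + t = 1"
      have "s * (fst (fst z) \<bullet> v + y \<bullet> snd (fst z) - y \<bullet> v)
          + t * (fst (fst w) \<bullet> v + y \<bullet> snd (fst w) - y \<bullet> v) \<le> s * snd z + t * snd w"
        using zw st by (intro add_mono mult_left_mono) auto
      moreover have "s * (y \<bullet> v) + t * (y \<bullet> v) = y \<bullet> v"
        using st by (metis distrib_right mult_1)
      ultimately show "s *\<^sub>R z + t *\<^sub>R w \<in> ?S"
        by (simp add: inner_add_left inner_add_right algebra_simps)
    qed
    then show ?thesis unfolding E_def by (auto intro!: convex_INT)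
  qed
  moreover have graph: "((y, v), y \<bullet> v) \<in> E" if "v \<in> M y" for y v
    unfolding E_iff
  proof (intro allI impI)
    fix y' v' assume "v' \<in> M y'"
    from monotone_opD[OF mono that this] show "y \<bullet> v' + y' \<bullet> v - y' \<bullet> v' \<le> y \<bullet> v"
      by (simp add: inner_diff_left inner_diff_right)
  qed
  then have "E \<noteq> {}" using maximally_monotone_nonempty[OF M] by blast
  moreover have above: "x \<bullet> u \<le> r" if "((x, u), r) \<in> E" for x u r
  proof (rule ccontr)
    assume neg: "\<not> x \<bullet> u \<le> r"
    have "u \<in> M x"
    proof (rule maximally_monotoneD[OF M])
      fix y v assume "v \<in> M y"
      with that have "x \<bullet> v + y \<bullet> u - y \<bullet> v \<le> r" by (simp add: E_iff)
      with neg show "0 \<le> (x - y) \<bullet> (u - v)"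
        by (simp add: inner_diff_left inner_diff_right)
    qed
    with that have "x \<bullet> u + x \<bullet> u - x \<bullet> u \<le> r" unfolding E_iff by blast
    with neg show False by simp
  qed
  moreover have "0 \<le> r + (norm p)\<^sup>2 / 2" if "(p, r) \<in> E" for p r
  proof -
    obtain x u where p: "p = (x, u)" by (cases p)
    have "0 \<le> (x + u) \<bullet> (x + u)" by simp
    moreover have "x \<bullet> u \<le> r" using above that by (simp add: p)
    ultimately show ?thesis
      unfolding p power2_norm_eq_inner
      by (simp add: inner_add_left inner_add_right inner_commute field_simps)
  qed
  ultimately obtain p r where pE: "(p, r) \<in> E"
    and opt: "\<And>q t. (q, t) \<in> E \<Longrightarrow> r + p \<bullet> p \<le> t + p \<bullet> q"
    using strongly_convex_minimiser[of E] by blast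
  obtain a b where p: "p = (a, b)" by (cases p)
  have ab: "a \<bullet> b \<le> r" using above pE p by simp
  have key: "(a + b) \<bullet> (a + b) \<le> (- b - y) \<bullet> (- a - v)" if "v \<in> M y" for y v
    using opt[OF graph[OF that]] ab
    by (simp add: p inner_add_left inner_add_right inner_diff_left inner_diff_right inner_commute)
  have "- a \<in> M (- b)"
    by (rule maximally_monotoneD[OF M]) (use key inner_ge_zero order_trans in blast)
  moreover from key[OF this] have "(a + b) \<bullet> (a + b) \<le> 0" by simp
  then have "a + b = 0" by (metis inner_eq_zero_iff inner_ge_zero order_antisym)
  then have "a = - b" by (simp add: eq_neg_iff_add_eq_0)
  ultimately show thesis using that[of "- b"] by simp
qed

lemma minty:
  fixes M :: "'h::{real_inner, complete_space} \<Rightarrow> 'h set"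
  assumes M: "maximally_monotone M" and "0 < e"
  obtains x where "u - e *\<^sub>R x \<in> M x"
proof -
  define N where "N y = {v. u + e *\<^sub>R v \<in> M y}" for y
  have scale: "(x - y) \<bullet> ((u + e *\<^sub>R w) - (u + e *\<^sub>R v)) = e * ((x - y) \<bullet> (w - v))" for x y w v
    by (simp add: algebra_simps)
  have "maximally_monotone N"
    unfolding maximally_monotone_iff
  proof (intro conjI allI impI)
    show "monotone_op N"
      unfolding monotone_op_def
    proof clarsimp
      fix x w y v assume "(x, w) \<in> gra N" "(y, v) \<in> gra N"
      then have "0 \<le> (x - y) \<bullet> ((u + e *\<^sub>R w) - (u + e *\<^sub>R v))"
        using M by (intro monotone_opD[of M]) (auto simp: gra_def N_def maximally_monotone_def)
      then show "0 \<le> (x - y) \<bullet> (w - v)"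
        using \<open>0 < e\<close> by (simp only: scale zero_le_mult_iff) auto
    qed
  next
    fix x w assume rel: "\<forall>y v. v \<in> N y \<longrightarrow> 0 \<le> (x - y) \<bullet> (w - v)"
    have "u + e *\<^sub>R w \<in> M x"
    proof (rule maximally_monotoneD[OF M])
      fix y v assume v: "v \<in> M y"
      define v' where "v' = (1 / e) *\<^sub>R (v - u)"
      have v': "v = u + e *\<^sub>R v'" using \<open>0 < e\<close> by (simp add: v'_def)
      with v rel have "0 \<le> (x - y) \<bullet> (w - v')" by (simp add: N_def)
      then show "0 \<le> (x - y) \<bullet> (u + e *\<^sub>R w - v)"
        unfolding v' scale using \<open>0 < e\<close> by simp
    qed
    then show "w \<in> N x" by (simp add: N_def)
  qed
  then obtain x where "- x \<in> N x" by (rule minty_at_zero)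
  then show thesis using that by (simp add: N_def)
qed

section \<open>Convergence of bounded regularised solutions\<close>

text \<open>
  Monotonicity tested at the two solutions yields \<open>0 \<le> a \<bullet> (b - a)\<close>, and expanding
  \<open>\<bar>a + (b - a)\<bar>\<^sup>2\<close> gives the claim. Along the regularisation path the growth of the norm thus
  controls the distance between solutions.
\<close>

lemma regularised_solution_gap:
  assumes "monotone_op M" "0 < d" "d \<le> e"
    and "u - e *\<^sub>R a \<in> M a" "u - d *\<^sub>R b \<in> M b"
  shows "(norm (b - a))\<^sup>2 \<le> (norm b)\<^sup>2 - (norm a)\<^sup>2"
proof -
  have "0 \<le> (a - b) \<bullet> ((u - e *\<^sub>R a) - (u - d *\<^sub>R b))"
    using assms by (intro monotone_opD[of M])
  also have "\<dots> = (e - d) * (a \<bullet> (b - a)) - d * (norm (b - a))\<^sup>2"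
    unfolding power2_norm_eq_inner
    by (simp add: inner_diff_left inner_diff_right inner_commute algebra_simps)
  finally have *: "d * (norm (b - a))\<^sup>2 \<le> (e - d) * (a \<bullet> (b - a))" by simp
  have "0 \<le> a \<bullet> (b - a)"
  proof (cases "e = d")
    case True
    with * \<open>0 < d\<close> show ?thesis by (simp add: mult_le_0_iff)
  next
    case False
    have "0 \<le> d * (norm (b - a))\<^sup>2" using \<open>0 < d\<close> by simp
    with * have "0 \<le> (e - d) * (a \<bullet> (b - a))" by linarith
    with False \<open>d \<le> e\<close> show ?thesis by (simp add: zero_le_mult_iff)
  qed
  then show ?thesis
    unfolding power2_norm_eq_inner
    by (simp add: inner_diff_left inner_diff_right inner_commute)
qed

text \<open>
  The squared norms form a bounded increasing sequence, hence a Cauchy sequence, and the gap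
  inequality transfers this to \<open>x\<close>. In this way boundedness yields strong convergence without
  passing to weakly convergent subsequences.
\<close>

lemma convergent_if_norm_gap:
  fixes x :: "nat \<Rightarrow> 'a::{real_normed_vector, complete_space}"
  assumes gap: "\<And>m n. m \<le> n \<Longrightarrow> (norm (x n - x m))\<^sup>2 \<le> (norm (x n))\<^sup>2 - (norm (x m))\<^sup>2"
    and bdd: "bounded (range x)"
  shows "convergent x"
proof -
  obtain b where b: "\<And>n. norm (x n) \<le> b" using bdd by (auto simp: bounded_iff)
  have "incseq (\<lambda>n. (norm (x n))\<^sup>2)"
    by (rule incseq_SucI) (smt (verit) gap le_SucI order_refl zero_le_power2)
  moreover have "(norm (x n))\<^sup>2 \<le> b\<^sup>2" for n
    using b by (intro power_mono) auto
  ultimately have "convergent (\<lambda>n. (norm (x n))\<^sup>2)"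
    by (metis convergent_def incseq_convergent)
  then have C: "Cauchy (\<lambda>n. (norm (x n))\<^sup>2)" by (simp add: Cauchy_convergent_iff)
  have "Cauchy x"
  proof (rule CauchyI')
    fix e :: real assume "e > 0"
    then obtain N where
      N: "\<And>m n. m \<ge> N \<Longrightarrow> n \<ge> N \<Longrightarrow> \<bar>(norm (x m))\<^sup>2 - (norm (x n))\<^sup>2\<bar> < e\<^sup>2"
      using CauchyD[OF C, of "e\<^sup>2"] by auto
    have "dist (x m) (x n) < e" if "N \<le> m" "m < n" for m n
    proof -
      have "(norm (x n - x m))\<^sup>2 < e\<^sup>2"
        using gap[of m n] N[of n m] that by linarith
      then show ?thesis
        using \<open>e > 0\<close> by (simp add: dist_norm norm_minus_commute power2_less_imp_less)
    qed
    then show "\<exists>M. \<forall>m\<ge>M. \<forall>n>m. dist (x m) (x n) < e" by blast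
  qed
  then show ?thesis by (rule Cauchy_convergent)
qed

lemma graph_closed:
  assumes M: "maximally_monotone M" and "x \<longlonglongrightarrow> a" "w \<longlonglongrightarrow> u" and mem: "\<And>n. w n \<in> M (x n)"
  shows "u \<in> M a"
proof (rule maximally_monotoneD[OF M])
  fix y v assume "v \<in> M y"
  have "(\<lambda>n. (x n - y) \<bullet> (w n - v)) \<longlonglongrightarrow> (a - y) \<bullet> (u - v)"
    by (intro tendsto_intros assms)
  moreover have "0 \<le> (x n - y) \<bullet> (w n - v)" for n
    using M mem \<open>v \<in> M y\<close> by (intro monotone_opD[of M]) (auto simp: maximally_monotone_def)
  ultimately show "0 \<le> (a - y) \<bullet> (u - v)"
    by (intro LIMSEQ_le_const) auto
qed

lemma range_if_bounded_regularised_solutions: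
  fixes M :: "'h::{real_inner, complete_space} \<Rightarrow> 'h set"
  assumes M: "maximally_monotone M"
    and x: "\<And>n. u - inverse (real (Suc n)) *\<^sub>R x n \<in> M (x n)"
    and bdd: "bounded (range x)"
  shows "u \<in> op_ran M"
proof -
  have "convergent x"
  proof (rule convergent_if_norm_gap[OF _ bdd])
    fix m n :: nat assume "m \<le> n"
    then show "(norm (x n - x m))\<^sup>2 \<le> (norm (x n))\<^sup>2 - (norm (x m))\<^sup>2"
      using M x by (intro regularised_solution_gap[of M "inverse (real (Suc n))"
            "inverse (real (Suc m))"]) (auto simp: maximally_monotone_def intro!: le_imp_inverse_le)
  qed
  then obtain a where a: "x \<longlonglongrightarrow> a" by (auto simp: convergent_def)
  have "(\<lambda>n. u - inverse (real (Suc n)) *\<^sub>R x n) \<longlonglongrightarrow> u - 0 *\<^sub>R a"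
    by (intro tendsto_intros a LIMSEQ_inverse_real_of_nat)
  then have "u \<in> M a" using graph_closed[OF M a _ x] by simp
  then show ?thesis by (auto simp: op_ran_def op_image_def)
qed

section \<open>Uniform boundedness in a closed subspace\<close>

text \<open>
  The sublevel sets \<open>{z \<in> S. \<forall>x\<in>X. x \<bullet> z \<le> n}\<close> are closed and cover \<open>S\<close>, so by Baire's theorem
  one of them contains a relative ball around some \<open>w\<close>. Moving from \<open>w\<close> in the direction of
  \<open>x \<in> X\<close> bounds \<open>x \<bullet> w + (r / 2) * norm x\<close>, and the one-sided bound at \<open>- w\<close> removes \<open>x \<bullet> w\<close>.
\<close>

lemma uniform_boundedness:
  fixes S :: "'a::{real_inner, complete_space} set"
  assumes "closed S" "subspace S" "X \<subseteq> S"
    and pointwise: "\<And>z. z \<in> S \<Longrightarrow> \<exists>b. \<forall>x\<in>X. x \<bullet> z \<le> b"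
  shows "bounded X"
proof -
  define T where "T n = {z \<in> S. \<forall>x\<in>X. x \<bullet> z \<le> real n}" for n
  have T_closed: "closedin (top_of_set S) (T n)" for n
  proof -
    have "T n = S \<inter> (\<Inter>x\<in>X. {z. x \<bullet> z \<le> real n})" by (auto simp: T_def)
    moreover have "closed (\<Inter>x\<in>X. {z. x \<bullet> z \<le> real n})"
      by (intro closed_INT ballI closed_halfspace_le)
    ultimately show ?thesis by (metis closedin_closed_Int)
  qed
  have "S \<subseteq> \<Union>(range T)"
  proof
    fix z assume z: "z \<in> S"
    then obtain b where "\<forall>x\<in>X. x \<bullet> z \<le> b" using pointwise by blast
    moreover obtain n where "b \<le> real n" using real_arch_simple by blast
    ultimately have "z \<in> T n" using z by (auto simp: T_def intro: order_trans)
    then show "z \<in> \<Union>(range T)" by blast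
  qed
  then have S_eq: "\<Union>(range T) = topspace (top_of_set S)" by (auto simp: T_def)
  have "\<exists>n. (top_of_set S) interior_of T n \<noteq> {}"
  proof (rule ccontr)
    assume "\<not> ?thesis"
    moreover have "completely_metrizable_space (top_of_set S)"
      using \<open>closed S\<close> unfolding closed_closedin
      by (rule completely_metrizable_space_closedin[OF completely_metrizable_space_euclidean])
    ultimately have "(top_of_set S) interior_of \<Union>(range T) = {}"
      using T_closed by (intro Baire_category_alt) blast+
    then have "S = {}"
      using interior_of_topspace[of "top_of_set S"] by (simp add: S_eq)
    then show False using subspace_0[OF \<open>subspace S\<close>] by simp
  qed
  then obtain n w where "w \<in> (top_of_set S) interior_of T n" by blast
  then obtain U where U: "openin (top_of_set S) U" "w \<in> U" "U \<subseteq> T n"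
    by (auto simp: interior_of_def)
  then obtain r where "0 < r" and "ball w r \<inter> S \<subseteq> U"
    unfolding openin_contains_ball by blast
  then have r: "\<And>z. z \<in> S \<Longrightarrow> dist w z < r \<Longrightarrow> z \<in> T n" using U by auto
  have wS: "w \<in> S" using U by (auto simp: T_def)
  then obtain b where b: "\<And>x. x \<in> X \<Longrightarrow> x \<bullet> (- w) \<le> b"
    using pointwise[of "- w"] subspace_neg[OF \<open>subspace S\<close>] by blast
  have "norm x \<le> \<bar>(real n + b) * 2 / r\<bar>" if "x \<in> X" for x
  proof (cases "x = 0")
    case False
    define z where "z = w + (r / 2 / norm x) *\<^sub>R x"
    have "z \<in> S" using wS that \<open>X \<subseteq> S\<close> \<open>subspace S\<close>
      by (auto simp: z_def intro: subspace_add subspace_scale)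
    moreover have "dist w z < r" using False \<open>0 < r\<close> by (simp add: z_def dist_norm)
    ultimately have "x \<bullet> z \<le> real n" using r that by (auto simp: T_def)
    moreover have "x \<bullet> z = x \<bullet> w + r / 2 * norm x"
      using False by (simp add: z_def inner_add_right dot_square_norm power2_eq_square)
    ultimately have "r * norm x \<le> (real n + b) * 2" using b[OF that] by simp
    then have "norm x \<le> (real n + b) * 2 / r" using \<open>0 < r\<close> by (simp add: field_simps)
    then show ?thesis by linarith
  qed simp
  then show ?thesis by (auto simp: bounded_iff)
qed

section \<open>The range theorem\<close>

text \<open>
  The Fitzpatrick function of \<open>M\<close> at \<open>(x, u)\<close> is \<open>x \<bullet> u\<close> minus the infimum of
  \<open>(x - y) \<bullet> (u - v)\<close> over the graph. Tame points are thus the second components of the points of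
  its effective domain.
\<close>

definition tame_points :: "('a::real_inner \<Rightarrow> 'a set) \<Rightarrow> 'a set" where
  "tame_points M = {u. \<exists>x c. \<forall>y v. v \<in> M y \<longrightarrow> c \<le> (x - y) \<bullet> (u - v)}"

text \<open>
  Testing tameness at the regularised solution \<open>y\<close> bounds \<open>e * (norm y)\<^sup>2\<close> by a constant, so
  that \<open>e *\<^sub>R y\<close> has norm of order \<open>sqrt e\<close>.
\<close>

lemma tame_points_subset_closure_range:
  fixes M :: "'h::{real_inner, complete_space} \<Rightarrow> 'h set"
  assumes M: "maximally_monotone M"
  shows "tame_points M \<subseteq> closure (op_ran M)"
proof
  fix u assume "u \<in> tame_points M"
  then obtain x c where c: "\<And>y v. v \<in> M y \<Longrightarrow> c \<le> (x - y) \<bullet> (u - v)"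
    by (auto simp: tame_points_def)
  define e where "e n = inverse (real (Suc n))" for n
  have e0: "0 < e n" for n by (simp add: e_def)
  have "\<exists>y. u - e n *\<^sub>R y \<in> M y" for n using minty[OF M e0] by blast
  then obtain y where y: "\<And>n. u - e n *\<^sub>R y n \<in> M (y n)" by metis
  have bound: "(norm (e n *\<^sub>R y n))\<^sup>2 \<le> e n * (e n * (norm x)\<^sup>2 - 2 * c)" for n
  proof -
    have "c \<le> (x - y n) \<bullet> (u - (u - e n *\<^sub>R y n))" using y by (rule c)
    also have "\<dots> = e n * (x \<bullet> y n - (norm (y n))\<^sup>2)"
      unfolding power2_norm_eq_inner by (simp add: inner_diff_left)
    also have "\<dots> \<le> e n * (((norm x)\<^sup>2 - (norm (y n))\<^sup>2) / 2)"
    proof (rule mult_left_mono)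
      have "0 \<le> (norm (x - y n))\<^sup>2" by simp
      then show "x \<bullet> y n - (norm (y n))\<^sup>2 \<le> ((norm x)\<^sup>2 - (norm (y n))\<^sup>2) / 2"
        unfolding power2_norm_eq_inner
        by (simp add: inner_diff_left inner_diff_right inner_commute)
    qed (use e0[of n] in simp)
    finally have "e n * (norm (y n))\<^sup>2 \<le> e n * (norm x)\<^sup>2 - 2 * c"
      by (simp add: algebra_simps)
    then have "e n * (e n * (norm (y n))\<^sup>2) \<le> e n * (e n * (norm x)\<^sup>2 - 2 * c)"
      using e0[of n] by (intro mult_left_mono) auto
    then show ?thesis by (simp add: power_mult_distrib power2_eq_square mult.assoc mult.left_commute)
  qed
  have e_lim: "e \<longlonglongrightarrow> 0"
    unfolding e_def by (rule LIMSEQ_inverse_real_of_nat)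
  have "(\<lambda>n. e n * (e n * (norm x)\<^sup>2 - 2 * c)) \<longlonglongrightarrow> 0 * (0 * (norm x)\<^sup>2 - 2 * c)"
    by (intro tendsto_intros e_lim)
  then have lim: "(\<lambda>n. e n * (e n * (norm x)\<^sup>2 - 2 * c)) \<longlonglongrightarrow> 0"
    by (simp only: mult_zero_left)
  have "(\<lambda>n. (norm (e n *\<^sub>R y n))\<^sup>2) \<longlonglongrightarrow> 0"
    by (rule real_tendsto_sandwich[OF _ _ tendsto_const lim])
      (simp_all only: bound zero_le_power2 eventually_True)
  then have "(\<lambda>n. sqrt ((norm (e n *\<^sub>R y n))\<^sup>2)) \<longlonglongrightarrow> sqrt 0"
    by (rule tendsto_real_sqrt)
  then have "(\<lambda>n. norm (e n *\<^sub>R y n)) \<longlonglongrightarrow> 0"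
    by (simp only: real_sqrt_abs abs_norm_cancel real_sqrt_zero)
  then have "(\<lambda>n. e n *\<^sub>R y n) \<longlonglongrightarrow> 0"
    by (rule tendsto_norm_zero_cancel)
  then have "(\<lambda>n. u - e n *\<^sub>R y n) \<longlonglongrightarrow> u - 0"
    by (intro tendsto_intros)
  moreover have "u - e n *\<^sub>R y n \<in> op_ran M" for n
    using y by (auto simp: op_ran_def op_image_def)
  ultimately show "u \<in> closure (op_ran M)"
    unfolding closure_sequential by (intro exI[of _ "\<lambda>n. u - e n *\<^sub>R y n"]) auto
qed

lemma closed_affine_hull_properties:
  "affine (closed_affine_hull C)" "closed (closed_affine_hull C)" "C \<subseteq> closed_affine_hull C"
proof -
  have "affine (closed_affine_hull C) \<and> closed (closed_affine_hull C)"
    unfolding closed_affine_hull_def by (rule hull_in) auto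
  then show "affine (closed_affine_hull C)" "closed (closed_affine_hull C)" by auto
  show "C \<subseteq> closed_affine_hull C"
    unfolding closed_affine_hull_def by (rule hull_subset)
qed

lemma closed_affine_hull_closure: "closed_affine_hull (closure C) = closed_affine_hull C"
proof
  show "closed_affine_hull C \<subseteq> closed_affine_hull (closure C)"
    unfolding closed_affine_hull_def by (rule hull_mono) (rule closure_subset)
  have "closure C \<subseteq> closed_affine_hull C"
    using closed_affine_hull_properties by (intro closure_minimal)
  then show "closed_affine_hull (closure C) \<subseteq> closed_affine_hull C"
    using closed_affine_hull_properties[of C]
    unfolding closed_affine_hull_def[of "closure C"] by (intro hull_minimal) auto
qed

lemma rintE:
  assumes "u \<in> rint C"
  obtains r where "0 < r" "\<And>z. z \<in> closed_affine_hull C \<Longrightarrow> dist u z < r \<Longrightarrow> z \<in> C"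
proof -
  obtain U where U: "openin (top_of_set (closed_affine_hull C)) U" "u \<in> U" "U \<subseteq> C"
    using assms by (auto simp: rint_def interior_of_def)
  then obtain r where r: "0 < r" "ball u r \<inter> closed_affine_hull C \<subseteq> U"
    unfolding openin_contains_ball by blast
  show thesis by (rule that[OF r(1)]) (use r(2) U in auto)
qed

text \<open>
  Since the range lies in the closed affine hull, so does \<open>u - e *\<^sub>R y\<close>, which forces the
  regularised solution \<open>y\<close> itself into the direction space of the hull. It is therefore enough to
  bound \<open>y\<close> against the directions \<open>z\<close> of that space, and for small \<open>z\<close> this is the tameness of
  \<open>u + z\<close>.
\<close>

lemma rint_subset_range:
  fixes M :: "'h::{real_inner, complete_space} \<Rightarrow> 'h set"
  assumes M: "maximally_monotone M" and ran: "op_ran M \<subseteq> C" and tame: "C \<subseteq> tame_points M"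
  shows "rint C \<subseteq> op_ran M"
proof
  fix u assume "u \<in> rint C"
  then obtain r where r: "0 < r" "\<And>z. z \<in> closed_affine_hull C \<Longrightarrow> dist u z < r \<Longrightarrow> z \<in> C"
    using rintE by metis
  have uV: "u \<in> closed_affine_hull C"
    using \<open>u \<in> rint C\<close> interior_of_subset_topspace by (fastforce simp: rint_def)
  define S where "S = (\<lambda>x. x - u) ` closed_affine_hull C"
  have S_iff: "z \<in> S \<longleftrightarrow> u + z \<in> closed_affine_hull C" for z
    unfolding S_def by (force simp: image_iff algebra_simps)
  have "subspace S"
    unfolding S_def using closed_affine_hull_properties uV by (intro affine_diffs_subspace_subtract)
  have "closed S"
    unfolding S_def by (intro closed_translation_subtract closed_affine_hull_properties)
  define e where "e n = inverse (real (Suc n))" for n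
  have e: "0 < e n" "e n \<le> 1" for n by (auto simp: e_def field_simps)
  have "\<exists>y. u - e n *\<^sub>R y \<in> M y" for n using minty[OF M e(1)] by blast
  then obtain y where y: "\<And>n. u - e n *\<^sub>R y n \<in> M (y n)" by metis
  \<comment> \<open>Otherwise the bounds against directions in \<open>S\<close> would not control the norm of \<open>y n\<close>.\<close>
  have yS: "y n \<in> S" for n
  proof -
    have "u - e n *\<^sub>R y n \<in> closed_affine_hull C"
      using y ran closed_affine_hull_properties(3)[of C]
      by (auto simp: op_ran_def op_image_def)
    then have "- (e n *\<^sub>R y n) \<in> S" by (simp add: S_iff)
    then have "(- 1 / e n) *\<^sub>R (- (e n *\<^sub>R y n)) \<in> S"
      by (rule subspace_scale[OF \<open>subspace S\<close>])
    then show ?thesis using e(1)[of n] by simp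
  qed
  have small: "\<exists>b. \<forall>n. y n \<bullet> z \<le> b" if "z \<in> S" "norm z < r" for z
  proof -
    have "u + z \<in> C" using that r by (auto simp: S_iff dist_norm)
    with tame have "u + z \<in> tame_points M" by blast
    then obtain x c where c: "\<And>y v. v \<in> M y \<Longrightarrow> c \<le> (x - y) \<bullet> (u + z - v)"
      by (auto simp: tame_points_def)
    have "y n \<bullet> z \<le> x \<bullet> z - c + (norm x)\<^sup>2" for n
    proof -
      have "c \<le> (x - y n) \<bullet> (u + z - (u - e n *\<^sub>R y n))" using y by (rule c)
      also have "\<dots> = x \<bullet> z - y n \<bullet> z + e n * (x \<bullet> y n - (norm (y n))\<^sup>2)"
        unfolding power2_norm_eq_inner
        by (simp add: inner_diff_left inner_add_right algebra_simps)
      also have "e n * (x \<bullet> y n - (norm (y n))\<^sup>2) \<le> e n * (norm x)\<^sup>2"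
      proof (rule mult_left_mono)
        have "2 * (x \<bullet> y n) \<le> x \<bullet> x + y n \<bullet> y n"
          using inner_ge_zero[of "x - y n"]
          by (simp add: inner_diff_left inner_diff_right inner_commute)
        then show "x \<bullet> y n - (norm (y n))\<^sup>2 \<le> (norm x)\<^sup>2"
          unfolding power2_norm_eq_inner
          using inner_ge_zero[of x] inner_ge_zero[of "y n"] by linarith
      qed (use e(1)[of n] in simp)
      also have "e n * (norm x)\<^sup>2 \<le> (norm x)\<^sup>2"
        using e[of n] by (intro mult_left_le_one_le) auto
      finally show ?thesis by simp
    qed
    then show ?thesis by blast
  qed
  have "\<exists>b. \<forall>x\<in>range y. x \<bullet> z \<le> b" if z: "z \<in> S" for z
  proof -
    have pos: "0 < norm z + 1" by (intro add_nonneg_pos) auto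
    define t where "t = r / (2 * (norm z + 1))"
    have t: "0 < t" using r(1) pos by (simp add: t_def)
    have "norm (t *\<^sub>R z) = t * norm z" using t by simp
    also have "\<dots> = r / 2 * (norm z / (norm z + 1))" by (simp add: t_def)
    also have "\<dots> \<le> r / 2 * 1"
      using r(1) pos by (intro mult_left_mono) (auto simp: divide_le_eq_1)
    also have "\<dots> < r" using r(1) by simp
    finally obtain b where b: "\<And>n. y n \<bullet> (t *\<^sub>R z) \<le> b"
      using small[of "t *\<^sub>R z"] z subspace_scale[OF \<open>subspace S\<close>] by blast
    have "y n \<bullet> z \<le> b / t" for n using b[of n] t by (simp add: field_simps)
    then show ?thesis by blast
  qed
  then have "bounded (range y)"
    using \<open>closed S\<close> \<open>subspace S\<close> yS by (intro uniform_boundedness[of S]) auto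
  then show "u \<in> op_ran M"
    using M y unfolding e_def by (rule range_if_bounded_regularised_solutions[rotated 2])
qed

theorem range_nearly_equal:
  fixes M :: "'h::{real_inner, complete_space} \<Rightarrow> 'h set"
  assumes M: "maximally_monotone M" and ran: "op_ran M \<subseteq> C" and tame: "C \<subseteq> tame_points M"
  shows "op_ran M \<simeq>\<^sub>n C"
proof -
  have "C \<subseteq> closure (op_ran M)"
    using tame tame_points_subset_closure_range[OF M] by blast
  then have cl: "closure (op_ran M) = closure C"
    using ran by (metis closure_closure closure_mono subset_antisym)
  then have hull: "closed_affine_hull (op_ran M) = closed_affine_hull C"
    by (metis closed_affine_hull_closure)
  have "rint C \<subseteq> op_ran M" using assms by (rule rint_subset_range)
  then have "rint C \<subseteq> rint (op_ran M)"
    unfolding rint_def hull by (intro interior_of_maximal) auto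
  moreover have "rint (op_ran M) \<subseteq> rint C"
    unfolding rint_def hull using ran by (rule interior_of_mono)
  ultimately show ?thesis using cl by (simp add: nearly_equal_def)
qed

section \<open>Sums of compositions with linear relations\<close>

lemma sum_op_apply: "(\<Sum>k\<in>K. F k) x = (\<Sum>k\<in>K. F k x)"
  for F :: "'k \<Rightarrow> 'a \<Rightarrow> 'b::comm_monoid_add set"
  by (induction K rule: infinite_finite_induct) auto

lemma three_star_lower_bound:
  assumes "three_star_monotone B" "x \<in> op_dom B" "u \<in> op_ran B"
  obtains c where "\<And>y v. v \<in> B y \<Longrightarrow> c \<le> (x - y) \<bullet> (u - v)"
proof -
  let ?I = "INF (y, v)\<in>gra B. ereal ((x - y) \<bullet> (u - v))"
  have "- \<infinity> < ?I" using assms by (auto simp: three_star_monotone_def)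
  then obtain c where c: "ereal c < ?I" using ereal_dense2[of "- \<infinity>" ?I] by auto
  have "c \<le> (x - y) \<bullet> (u - v)" if "v \<in> B y" for y v
  proof -
    have "?I \<le> ereal ((x - y) \<bullet> (u - v))"
      using that by (intro INF_lower2[of "(y, v)"]) (auto simp: gra_def)
    with c have "ereal c \<le> ereal ((x - y) \<bullet> (u - v))" by (meson less_imp_le order_trans)
    then show ?thesis by simp
  qed
  then show thesis using that by blast
qed

lemma adjoint_diff_inner:
  assumes L: "linear_rel L" and "a \<in> L x" "t \<in> L y"
    and "l \<in> adjoint_rel G L w" "m \<in> adjoint_rel G L s"
  shows "(x - y) \<bullet> (l - m) = (a - t) \<bullet> (w - s)"
proof -
  have "(x, a) - (y, t) \<in> gra L"
    using assms by (intro subspace_diff) (auto simp: linear_rel_def gra_def)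
  then have "(x - y, a - t) \<in> gra L" by simp
  then have "(x - y) \<bullet> l = (a - t) \<bullet> w" "(x - y) \<bullet> m = (a - t) \<bullet> s"
    using assms unfolding adjoint_rel_def by blast+
  then show ?thesis by (simp add: inner_diff_right)
qed

lemma composite_sum_iff:
  fixes A :: "'h::real_inner \<Rightarrow> 'h set" and B :: "'k \<Rightarrow> 'g::real_inner \<Rightarrow> 'g set"
  assumes "finite K"
  shows "u \<in> (A + (\<Sum>k\<in>K. adjoint_rel (G k) (L k) \<circ>\<^sub>o B k \<circ>\<^sub>o L k)) x \<longleftrightarrow>
    (\<exists>a m. a \<in> A x \<and> u = a + sum m K \<and>
      (\<forall>k\<in>K. \<exists>t s. t \<in> L k x \<and> s \<in> B k t \<and> m k \<in> adjoint_rel (G k) (L k) s))"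
proof -
  let ?F = "\<lambda>k. adjoint_rel (G k) (L k) \<circ>\<^sub>o B k \<circ>\<^sub>o L k"
  have comp: "v \<in> ?F k x \<longleftrightarrow> (\<exists>t s. t \<in> L k x \<and> s \<in> B k t \<and> v \<in> adjoint_rel (G k) (L k) s)"
    for k v
    by (auto simp: op_comp_def op_image_def)
  have "u \<in> (A + sum ?F K) x \<longleftrightarrow>
      (\<exists>a m. a \<in> A x \<and> u = a + sum m K \<and> (\<forall>k\<in>K. m k \<in> ?F k x))"
    unfolding plus_fun_apply sum_op_apply set_sum_alt[OF assms] set_plus_def by blast
  then show ?thesis unfolding comp .
qed

text \<open>
  Here the \<open>3\<^sup>*\<close>-monotonicity of the operators \<open>B k\<close> enters: the lower bound for a point of the
  right-hand side is the sum of the lower bounds for the operators \<open>B k\<close>.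
\<close>

lemma image_sum_subset_tame_points:
  fixes A :: "'h::real_inner \<Rightarrow> 'h set" and B :: "'k \<Rightarrow> 'g::real_inner \<Rightarrow> 'g set"
  assumes "finite K" and A: "monotone_op A"
    and B: "\<And>k. k \<in> K \<Longrightarrow> three_star_monotone (B k)"
    and L: "\<And>k. k \<in> K \<Longrightarrow> linear_rel (L k)"
    and D: "D \<subseteq> (\<Inter>k\<in>K. op_image (op_inv (L k)) (op_dom (B k)))"
  shows "op_image A D + (\<Sum>k\<in>K. op_image (adjoint_rel (G k) (L k)) (op_ran (B k)))
    \<subseteq> tame_points (A + (\<Sum>k\<in>K. adjoint_rel (G k) (L k) \<circ>\<^sub>o B k \<circ>\<^sub>o L k))"
proof
  fix u assume "u \<in> op_image A D + (\<Sum>k\<in>K. op_image (adjoint_rel (G k) (L k)) (op_ran (B k)))"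
  then obtain x a l where x: "x \<in> D" and a: "a \<in> A x" and u: "u = a + sum l K"
    and l: "\<forall>k\<in>K. l k \<in> op_image (adjoint_rel (G k) (L k)) (op_ran (B k))"
    unfolding set_sum_alt[OF \<open>finite K\<close>] by (auto simp: set_plus_def op_image_def)
  have "\<forall>k\<in>K. \<exists>w. w \<in> op_ran (B k) \<and> l k \<in> adjoint_rel (G k) (L k) w"
    using l by (auto simp: op_image_def)
  then obtain w where w: "\<And>k. k \<in> K \<Longrightarrow> w k \<in> op_ran (B k)"
    "\<And>k. k \<in> K \<Longrightarrow> l k \<in> adjoint_rel (G k) (L k) (w k)"
    by metis
  have "\<forall>k\<in>K. \<exists>z. z \<in> L k x \<and> z \<in> op_dom (B k)"
    using x D by (auto simp: op_image_def op_inv_def)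
  then obtain z where z: "\<And>k. k \<in> K \<Longrightarrow> z k \<in> L k x" "\<And>k. k \<in> K \<Longrightarrow> z k \<in> op_dom (B k)"
    by metis
  have "\<forall>k\<in>K. \<exists>c. \<forall>t s. s \<in> B k t \<longrightarrow> c \<le> (z k - t) \<bullet> (w k - s)"
    using three_star_lower_bound[OF B] z w by metis
  then obtain c where c: "\<And>k t s. k \<in> K \<Longrightarrow> s \<in> B k t \<Longrightarrow> c k \<le> (z k - t) \<bullet> (w k - s)"
    by metis
  have "sum c K \<le> (x - y) \<bullet> (u - v)"
    if vM: "v \<in> (A + (\<Sum>k\<in>K. adjoint_rel (G k) (L k) \<circ>\<^sub>o B k \<circ>\<^sub>o L k)) y" for y v
  proof -
    obtain b m where b: "b \<in> A y" and v: "v = b + sum m K"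
      and m: "\<forall>k\<in>K. \<exists>t s. t \<in> L k y \<and> s \<in> B k t \<and> m k \<in> adjoint_rel (G k) (L k) s"
      using vM unfolding composite_sum_iff[OF \<open>finite K\<close>] by blast
    have "c k \<le> (x - y) \<bullet> (l k - m k)" if k: "k \<in> K" for k
    proof -
      obtain t s where ts: "t \<in> L k y" "s \<in> B k t" "m k \<in> adjoint_rel (G k) (L k) s"
        using m k by blast
      have "c k \<le> (z k - t) \<bullet> (w k - s)" using c k ts(2) by blast
      also have "\<dots> = (x - y) \<bullet> (l k - m k)"
        by (rule adjoint_diff_inner[OF L[OF k] z(1)[OF k] ts(1) w(2)[OF k] ts(3), symmetric])
      finally show ?thesis .
    qed
    then have "sum c K \<le> (\<Sum>k\<in>K. (x - y) \<bullet> (l k - m k))" by (rule sum_mono)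
    also have "\<dots> = (x - y) \<bullet> (sum l K - sum m K)"
      by (simp add: inner_sum_right sum_subtractf[symmetric])
    also have "\<dots> \<le> (x - y) \<bullet> (a - b) + (x - y) \<bullet> (sum l K - sum m K)"
      using monotone_opD[OF A a b] by simp
    also have "\<dots> = (x - y) \<bullet> (u - v)"
      by (simp add: u v inner_diff_right inner_add_right)
    finally show ?thesis .
  qed
  then show "u \<in> tame_points (A + (\<Sum>k\<in>K. adjoint_rel (G k) (L k) \<circ>\<^sub>o B k \<circ>\<^sub>o L k))"
    unfolding tame_points_def by blast
qed

theorem theorem8:
  fixes A :: "'h::{real_inner, complete_space} \<Rightarrow> 'h set"
    and K :: "'k set"
    and G :: "'k \<Rightarrow> 'g::real_inner set"
    and B :: "'k \<Rightarrow> 'g \<Rightarrow> 'g set"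
    and L :: "'k \<Rightarrow> 'h \<Rightarrow> 'g set"
    and D :: "'h set"
  assumes "finite K"
    and "\<And>k. k \<in> K \<Longrightarrow> subspace (G k) \<and> complete (G k)"
    and "monotone_op A"
    and "\<And>k. k \<in> K \<Longrightarrow> operator_between (G k) (G k) (B k) \<and> three_star_monotone (B k)"
    and "\<And>k. k \<in> K \<Longrightarrow> operator_between UNIV (G k) (L k) \<and> linear_rel (L k)"
    and "D = (\<Inter>k\<in>K. op_image (op_inv (L k)) (op_dom (B k)))"
    and "maximally_monotone (A + (\<Sum>k\<in>K. adjoint_rel (G k) (L k) \<circ>\<^sub>o B k \<circ>\<^sub>o L k))"
  shows "D \<noteq> {} \<and>
    op_ran (A + (\<Sum>k\<in>K. adjoint_rel (G k) (L k) \<circ>\<^sub>o B k \<circ>\<^sub>o L k))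
      \<simeq>\<^sub>n op_image A D + (\<Sum>k\<in>K. op_image (adjoint_rel (G k) (L k)) (op_ran (B k)))"
proof -
  let ?M = "A + (\<Sum>k\<in>K. adjoint_rel (G k) (L k) \<circ>\<^sub>o B k \<circ>\<^sub>o L k)"
  let ?C = "op_image A D + (\<Sum>k\<in>K. op_image (adjoint_rel (G k) (L k)) (op_ran (B k)))"
  have mem: "x \<in> D \<and> u \<in> ?C" if uM: "u \<in> ?M x" for x u
  proof -
    obtain a m where a: "a \<in> A x" and u: "u = a + sum m K"
      and m: "\<forall>k\<in>K. \<exists>t s. t \<in> L k x \<and> s \<in> B k t \<and> m k \<in> adjoint_rel (G k) (L k) s"
      using iffD1[OF composite_sum_iff[OF assms(1)] uM] by (elim exE conjE)
    have "x \<in> op_image (op_inv (L k)) (op_dom (B k))" if k: "k \<in> K" for k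
    proof -
      obtain t s where "t \<in> L k x" "s \<in> B k t" using m k by blast
      then show ?thesis by (auto simp: op_image_def op_inv_def op_dom_def)
    qed
    then have x: "x \<in> D" unfolding assms(6) by blast
    moreover have "a \<in> op_image A D" using a x by (auto simp: op_image_def)
    moreover have "sum m K \<in> (\<Sum>k\<in>K. op_image (adjoint_rel (G k) (L k)) (op_ran (B k)))"
    proof -
      have "m k \<in> op_image (adjoint_rel (G k) (L k)) (op_ran (B k))" if k: "k \<in> K" for k
      proof -
        obtain t s where "s \<in> B k t" "m k \<in> adjoint_rel (G k) (L k) s" using m k by blast
        then show ?thesis by (auto simp: op_image_def op_ran_def)
      qed
      then show ?thesis unfolding set_sum_alt[OF assms(1)] by blast
    qed
    ultimately show ?thesis unfolding u by blast
  qed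
  have "D \<noteq> {}" using maximally_monotone_nonempty[OF assms(7)] mem by blast
  moreover have "op_ran ?M \<subseteq> ?C" using mem by (auto simp: op_ran_def op_image_def)
  moreover have "?C \<subseteq> tame_points ?M"
    using assms by (intro image_sum_subset_tame_points) auto
  ultimately show ?thesis using range_nearly_equal[OF assms(7)] by blast
qed

end
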